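(* Consider the DSPI game with continuous interdiction in which each agent $f\in\mathcal F$, given $x^{-f}$, solves the linear program $$\max_{x^f,y^f}\ y^f_{t^f}-y^f_{s^f}\quad\text{s.t.}\quad y^f_v-y^f_u\le d^0_{uv}+\sum_{g\in\mathcal F}x^g_{uv}\ \ \forall (u,v)\in A,\quad \sum_{(u,v)\in A}c^f_{uv}x^f_{uv}\le b^f,\quad x^f\ge 0,\ y^f\ge 0 .$$ Then a point $(\chi^1,\dots,\chi^F)$ with $\chi^f=(x^f,y^f)$ is an equilibrium of this game (i.e. for each $f$, $\chi^f$ is an optimal solution of agent $f$'s linear program given $x^{-f}$) if and only if there exist multipliers $\lambda^f\in\mathbb R^m$, $\beta^f\in\mathbb R$ ($f\in\mathcal F$) such that $w=(w^1,\dots,w^F)$ with $w^f=(x^f,y^f,\lambda^f,\beta^f)$ is a solution of LCP$(q,M)$, where $q$ and $M$ are as defined in the context.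
   Context: $G=(V,A)$ is a finite directed network with $|V|=n$, $|A|=m$; $\mathcal F=\{1,\dots,F\}$ is the set of agents; agent $f$ has source $s^f$, target $t^f$ (with at least one directed $s^f$-$t^f$ path), budget $b^f>0$, costs $c^f\in\mathbb R^m$ with $c^f_{uv}>0$; $d^0\in\mathbb R^m$ is the vector of initial arc lengths, $d^0_{uv}>0$. LCP$(q,M)$: find $w$ with $w\ge 0$, $q+Mw\ge 0$, $w^T(q+Mw)=0$; such a $w$ is a solution. Definition of $q,M$. Let $\mathcal G\in\mathbb R^{m\times n}$ be the arc-node incidence matrix (row $(u,v)$ has $+1$ in column $u$, $-1$ in column $v$, and $0$ elsewhere), $\mathcal I_m$ the identity matrix. Let $\nu^f\in\mathbb R^n$ have entry $1$ at $s^f$, $-1$ at $t^f$ and $0$ elsewhere, and $\phi^f=(\mathbf 0_m,\nu^f)\in\mathbb R^{m+n}$. Let $$A^f=\begin{bmatrix}\mathcal I_m&\mathcal G\\ -(c^f)^T&\mathbf 0_n^T\end{bmatrix}\in\mathbb R^{(m+1)\times(m+n)},\qquad M^f=\begin{bmatrix}\mathbf 0&-(A^f)^T\\ A^f&\mathbf 0\end{bmatrix}\in\mathbb R^{(2m+n+1)\times(2m+n+1)} .$$ Let $\bar M^f\in\mathbb R^{(2m+n+1)\times(2m+n+1)}$, with rows and columns partitioned into blocks of sizes $m,n,m,1$, be the matrix whose only nonzero block is $\mathcal I_m$ in block position (third row block, first column block). Then $q=(\bar q^1,\dots,\bar q^F)$ with $\bar q^f=(\phi^f,d^0,b^f)$,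 and $M$ is the $F\times F$ block matrix whose $(f,f)$ block is $M^f$ and whose $(f,f')$ block for $f'\neq f$ is $\bar M^{f'}$. *)

theory Defs
  imports "HOL-Analysis.Analysis" "Graph_Theory.Digraph"
begin

text \<open>
  Nodes, arcs and agents are the elements of finite types, so that \<open>n\<close>, \<open>m\<close> and \<open>F\<close> are their
  cardinalities.  Block vectors and block matrices are indexed by sums (and, for the partition
  by agents, by a product) of index types.
\<close>

definition vjoin :: "real ^ 'i \<Rightarrow> real ^ 'j \<Rightarrow> real ^ ('i::finite + 'j::finite)" where
  "vjoin u v = (\<chi> k. case k of Inl i \<Rightarrow> u $ i | Inr j \<Rightarrow> v $ j)"

definition block_mat ::
  "real ^ 'j ^ 'i \<Rightarrow> real ^ 'l ^ 'i \<Rightarrow> real ^ 'j ^ 'k \<Rightarrow> real ^ 'l ^ 'k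
    \<Rightarrow> real ^ ('j::finite + 'l::finite) ^ ('i::finite + 'k::finite)" where
  "block_mat P Q R S =
    (\<chi> r. case r of Inl i \<Rightarrow> vjoin (P $ i) (Q $ i) | Inr k \<Rightarrow> vjoin (R $ k) (S $ k))"

definition stack :: "('f \<Rightarrow> real ^ 'i) \<Rightarrow> real ^ ('f::finite \<times> 'i::finite)" where
  "stack W = (\<chi> p. W (fst p) $ snd p)"

definition lcp_solution :: "real ^ 'i \<Rightarrow> real ^ 'i ^ 'i \<Rightarrow> real ^ 'i::finite \<Rightarrow> bool" where
  "lcp_solution q M w \<longleftrightarrow> 0 \<le> w \<and> 0 \<le> q + M *v w \<and> w \<bullet> (q + M *v w) = 0"


subsection \<open>The interdiction game\<close>

type_synonym ('a, 'v) strategy = "(real ^ 'a) \<times> (real ^ 'v)"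

text \<open>
  In the two definitions below only the components \<open>X g\<close> with \<open>g \<noteq> f\<close> of the profile \<open>X\<close> matter.
\<close>

definition agent_feasible ::
  "('v::finite, 'a::finite) pre_digraph \<Rightarrow> real ^ 'a \<Rightarrow> ('f::finite \<Rightarrow> real) \<Rightarrow> ('f \<Rightarrow> real ^ 'a)
    \<Rightarrow> 'f \<Rightarrow> ('f \<Rightarrow> real ^ 'a) \<Rightarrow> ('a, 'v) strategy \<Rightarrow> bool" where
  "agent_feasible G d0 b c f X = (\<lambda>(xf, yf).
     (\<forall>a \<in> arcs G. yf $ head G a - yf $ tail G a \<le> d0 $ a + (\<Sum>g\<in>UNIV. (X(f := xf)) g $ a)) \<and>
     (\<Sum>a\<in>arcs G. c f $ a * xf $ a) \<le> b f \<and> 0 \<le> xf \<and> 0 \<le> yf)"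

definition agent_optimal ::
  "('v::finite, 'a::finite) pre_digraph \<Rightarrow> ('f::finite \<Rightarrow> 'v) \<Rightarrow> ('f \<Rightarrow> 'v) \<Rightarrow> real ^ 'a
    \<Rightarrow> ('f \<Rightarrow> real) \<Rightarrow> ('f \<Rightarrow> real ^ 'a) \<Rightarrow> 'f \<Rightarrow> ('f \<Rightarrow> real ^ 'a) \<Rightarrow> ('a, 'v) strategy \<Rightarrow> bool" where
  "agent_optimal G s t d0 b c f X = (\<lambda>(xf, yf).
     agent_feasible G d0 b c f X (xf, yf) \<and>
     (\<forall>x' y'. agent_feasible G d0 b c f X (x', y') \<longrightarrow>
        y' $ t f - y' $ s f \<le> yf $ t f - yf $ s f))"

definition dspi_equilibrium ::
  "('v::finite, 'a::finite) pre_digraph \<Rightarrow> ('f::finite \<Rightarrow> 'v) \<Rightarrow> ('f \<Rightarrow> 'v) \<Rightarrow> real ^ 'a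
    \<Rightarrow> ('f \<Rightarrow> real) \<Rightarrow> ('f \<Rightarrow> real ^ 'a) \<Rightarrow> ('f \<Rightarrow> ('a, 'v) strategy) \<Rightarrow> bool" where
  "dspi_equilibrium G s t d0 b c P \<longleftrightarrow>
     (\<forall>f. agent_optimal G s t d0 b c f (\<lambda>g. fst (P g)) (P f))"


subsection \<open>The data of the complementarity problem\<close>

text \<open>
  Writing the \<open>+1\<close> and \<open>-1\<close> entries as differences makes the row of a loop, and
  \<open>od_vec s s\<close>, equal to zero.
\<close>

definition incidence :: "('v, 'a) pre_digraph \<Rightarrow> real ^ 'v::finite ^ 'a::finite" where
  "incidence G = (\<chi> a. axis (tail G a) 1 - axis (head G a) 1)"

definition od_vec :: "'v \<Rightarrow> 'v \<Rightarrow> real ^ 'v::finite" where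
  "od_vec s t = axis s 1 - axis t 1"

type_synonym ('a, 'v) lcp_index = "('a + 'v) + ('a + 1)"

definition A_mat ::
  "('v, 'a) pre_digraph \<Rightarrow> real ^ 'a \<Rightarrow> real ^ ('a::finite + 'v::finite) ^ ('a + 1)" where
  "A_mat G cf = block_mat (mat 1) (incidence G) (- rowvector cf) 0"

definition M_diag :: "('v, 'a) pre_digraph \<Rightarrow> real ^ 'a
    \<Rightarrow> real ^ ('a::finite, 'v::finite) lcp_index ^ ('a, 'v) lcp_index" where
  "M_diag G cf = block_mat 0 (- transpose (A_mat G cf)) (A_mat G cf) 0"

definition M_bar :: "real ^ ('a::finite, 'v::finite) lcp_index ^ ('a, 'v) lcp_index" where
  "M_bar = block_mat 0 0 (block_mat (mat 1) 0 0 0) 0"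

definition lcp_M :: "('v, 'a) pre_digraph \<Rightarrow> ('f::finite \<Rightarrow> real ^ 'a)
    \<Rightarrow> real ^ ('f \<times> ('a::finite, 'v::finite) lcp_index) ^ ('f \<times> ('a, 'v) lcp_index)" where
  "lcp_M G c = (\<chi> r k.
     (if fst r = fst k then M_diag G (c (fst r)) else M_bar) $ snd r $ snd k)"

definition lcp_q :: "('f::finite \<Rightarrow> 'v) \<Rightarrow> ('f \<Rightarrow> 'v) \<Rightarrow> real ^ 'a \<Rightarrow> ('f \<Rightarrow> real)
    \<Rightarrow> real ^ ('f \<times> ('a::finite, 'v::finite) lcp_index)" where
  "lcp_q s t d0 b = stack (\<lambda>f. vjoin (vjoin 0 (od_vec (s f) (t f))) (vjoin d0 (vec (b f))))"

end

theory Submission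
  imports Defs
begin

text \<open>
  Agent by agent, the complementarity problem is the Karush-Kuhn-Tucker system of the agent's
  linear program.  Sufficiency is weak duality.  For necessity, no feasible direction at an
  optimum decreases the objective, so by Farkas' lemma (separation from a finitely generated, hence
  closed, cone) the objective vector is a nonnegative combination of the normals of the active
  constraints.  Using only active normals makes complementary slackness automatic.  Since
  \<open>M_bar\<close> only shifts the arc lengths by the interdictions of the other agents, and all the scalar
  products in the complementarity condition are nonnegative, the big problem splits into those of
  the agents.
\<close>

subsection \<open>Multipliers for linear programs\<close>

text \<open>The combinations supported on \<open>T\<close> form a convex cone containing the
  generators, so the hull lies inside it. Indexing the coefficients by \<open>k\<close> rather than
  by points lets \<open>a\<close> repeat values and makes them directly usable as
  multipliers.\<close>

lemma convex_cone_hull_finite_image: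
  fixes a :: "'k::finite \<Rightarrow> 'e::real_vector"
  assumes "v \<in> convex_cone hull (a ` T)"
  obtains u where "\<And>k. 0 \<le> u k" "\<And>k. k \<notin> T \<Longrightarrow> u k = 0" "v = (\<Sum>k\<in>UNIV. u k *\<^sub>R a k)"
proof -
  define C where
    "C = {\<Sum>k\<in>UNIV. u k *\<^sub>R a k | u. (\<forall>k. 0 \<le> u k) \<and> (\<forall>k. k \<notin> T \<longrightarrow> u k = 0)}"
  have CI: "(\<Sum>k\<in>UNIV. u k *\<^sub>R a k) \<in> C" if "\<And>k. 0 \<le> u k" "\<And>k. k \<notin> T \<Longrightarrow> u k = 0" for u
    using that unfolding C_def by blast
  have CE: "\<exists>u. (\<forall>k. 0 \<le> u k) \<and> (\<forall>k. k \<notin> T \<longrightarrow> u k = 0) \<and> v = (\<Sum>k\<in>UNIV. u k *\<^sub>R a k)"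
    if "v \<in> C" for v
    using that unfolding C_def by blast
  have "convex_cone C"
    unfolding convex_cone_iff
  proof (intro conjI ballI allI impI)
    show "0 \<in> C"
      using CI[of "\<lambda>_. 0"] by simp
  next
    fix v w assume "v \<in> C" "w \<in> C"
    from CE[OF \<open>v \<in> C\<close>] obtain u where u: "\<forall>k. 0 \<le> u k" "\<forall>k. k \<notin> T \<longrightarrow> u k = 0"
      and v: "v = (\<Sum>k\<in>UNIV. u k *\<^sub>R a k)"
      by (elim exE conjE)
    from CE[OF \<open>w \<in> C\<close>] obtain u' where u': "\<forall>k. 0 \<le> u' k" "\<forall>k. k \<notin> T \<longrightarrow> u' k = 0"
      and w: "w = (\<Sum>k\<in>UNIV. u' k *\<^sub>R a k)"
      by (elim exE conjE)
    have "(\<Sum>k\<in>UNIV. (u k + u' k) *\<^sub>R a k) \<in> C"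
      by (rule CI) (use u u' in simp_all)
    then show "v + w \<in> C"
      unfolding v w by (simp add: scaleR_add_left sum.distrib)
  next
    fix v and r :: real assume "v \<in> C" "0 \<le> r"
    from CE[OF \<open>v \<in> C\<close>] obtain u where u: "\<forall>k. 0 \<le> u k" "\<forall>k. k \<notin> T \<longrightarrow> u k = 0"
      and v: "v = (\<Sum>k\<in>UNIV. u k *\<^sub>R a k)"
      by (elim exE conjE)
    have "(\<Sum>k\<in>UNIV. (r * u k) *\<^sub>R a k) \<in> C"
      by (rule CI) (use u \<open>0 \<le> r\<close> in simp_all)
    then show "r *\<^sub>R v \<in> C"
      unfolding v by (simp add: scaleR_sum_right)
  qed
  moreover have "a l \<in> C" if "l \<in> T" for l
  proof -
    have "(\<Sum>k\<in>UNIV. of_bool (k = l) *\<^sub>R a k) = (\<Sum>k\<in>UNIV. if k = l then a k else 0)"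
      by (intro sum.cong) auto
    then have "a l = (\<Sum>k\<in>UNIV. of_bool (k = l) *\<^sub>R a k)" by simp
    moreover have "(\<Sum>k\<in>UNIV. of_bool (k = l) *\<^sub>R a k) \<in> C"
      by (rule CI) (use that in auto)
    ultimately show ?thesis by (rule ssubst)
  qed
  ultimately have "convex_cone hull (a ` T) \<subseteq> C"
    by (metis hull_minimal image_subsetI)
  with assms have "v \<in> C" by (rule rev_subsetD)
  from CE[OF this] obtain u where "\<forall>k. 0 \<le> u k" "\<forall>k. k \<notin> T \<longrightarrow> u k = 0"
    "v = (\<Sum>k\<in>UNIV. u k *\<^sub>R a k)" by (elim exE conjE)
  then show thesis
    by (intro that[of u]) simp_all
qed

text \<open>A finitely generated cone is closed, so a hyperplane strictly separates \<open>v\<close>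
  from it; invariance under scaling then lets the separating level be replaced by 0.\<close>

lemma farkas_convex_cone_hull:
  fixes S :: "'e::euclidean_space set"
  assumes "finite S" "v \<notin> convex_cone hull S"
  obtains h where "h \<bullet> v < 0" "\<And>w. w \<in> S \<Longrightarrow> 0 \<le> h \<bullet> w"
proof -
  have "\<exists>h r. h \<bullet> v < r \<and> (\<forall>w \<in> convex_cone hull S. r < h \<bullet> w)"
    using assms
    by (intro separating_hyperplane_closed_point convex_convex_cone_hull closed_convex_cone_hull)
  then obtain h r where r: "h \<bullet> v < r" "\<And>w. w \<in> convex_cone hull S \<Longrightarrow> r < h \<bullet> w"
    by auto
  have "r < 0"
    using r(2)[OF convex_cone_hull_contains_0] by simp
  moreover have "0 \<le> h \<bullet> w" if "w \<in> S" for w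
  proof (rule ccontr)
    assume neg: "\<not> 0 \<le> h \<bullet> w"
    with \<open>r < 0\<close> have "0 \<le> r / (h \<bullet> w)"
      by (simp add: divide_nonpos_neg)
    \<comment> \<open>The scaled generator is a cone point where \<open>h\<close> takes exactly the
      value \<open>r\<close>, against strict separation.\<close>
    with that have "r < h \<bullet> ((r / (h \<bullet> w)) *\<^sub>R w)"
      by (intro r(2) convex_cone_hull_mul hull_inc)
    with neg show False by simp
  qed
  ultimately show thesis
    using r(1) by (intro that[of h]) auto
qed

lemma lp_minimum_multipliers:
  fixes a :: "'k::finite \<Rightarrow> 'e::euclidean_space"
  assumes feas: "\<And>k. \<beta> k \<le> a k \<bullet> z"
    and opt: "\<And>z'. (\<And>k. \<beta> k \<le> a k \<bullet> z') \<Longrightarrow> \<phi> \<bullet> z \<le> \<phi> \<bullet> z'"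
  obtains u where "\<And>k. 0 \<le> u k" "\<And>k. u k * (a k \<bullet> z - \<beta> k) = 0"
    "\<phi> = (\<Sum>k\<in>UNIV. u k *\<^sub>R a k)"
proof -
  define T where "T = {k. a k \<bullet> z = \<beta> k}"
  have "\<phi> \<in> convex_cone hull (a ` T)"
  proof (rule ccontr)
    \<comment> \<open>Farkas yields a direction \<open>h\<close> that strictly decreases the
      objective and lowers no active constraint.\<close>
    assume "\<phi> \<notin> convex_cone hull (a ` T)"
    then obtain h where h: "h \<bullet> \<phi> < 0" "\<And>k. k \<in> T \<Longrightarrow> 0 \<le> h \<bullet> a k"
      by (rule farkas_convex_cone_hull[rotated]) auto
    \<comment> \<open>Short steps along \<open>h\<close> stay feasible: active constraints by the
      sign of \<open>h \<bullet> a k\<close>, inactive ones by continuity. Finitely many constraints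
      then share one positive \<open>e\<close>.\<close>
    have "\<forall>\<^sub>F e in at_right 0. \<beta> k \<le> a k \<bullet> (z + e *\<^sub>R h)" for k
    proof (cases "k \<in> T")
      case True
      have "\<forall>\<^sub>F e in at_right (0::real). 0 < e"
        by (rule eventually_at_right_less)
      then show ?thesis
        by eventually_elim (use True h(2)[OF True] in \<open>simp add: T_def inner_add_right inner_commute\<close>)
    next
      case False
      then have "\<beta> k < a k \<bullet> z"
        using feas[of k] by (simp add: T_def)
      moreover have "((\<lambda>e. a k \<bullet> (z + e *\<^sub>R h)) \<longlongrightarrow> a k \<bullet> (z + 0 *\<^sub>R h)) (at_right 0)"
        by (intro tendsto_intros)
      ultimately have "\<forall>\<^sub>F e in at_right 0. \<beta> k < a k \<bullet> (z + e *\<^sub>R h)"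
        by (intro order_tendstoD) auto
      then show ?thesis
        by eventually_elim simp
    qed
    then have "\<forall>\<^sub>F e in at_right 0. (\<forall>k. \<beta> k \<le> a k \<bullet> (z + e *\<^sub>R h)) \<and> 0 < e"
      by (intro eventually_conj eventually_all_finite eventually_at_right_less)
    then obtain e where "\<And>k. \<beta> k \<le> a k \<bullet> (z + e *\<^sub>R h)" "0 < e"
      using eventually_happens' trivial_limit_at_right_real by blast
    with opt[of "z + e *\<^sub>R h"] have "0 \<le> h \<bullet> \<phi>"
      by (simp add: inner_add_right inner_commute zero_le_mult_iff)
    with h(1) show False by simp
  qed
  then obtain u where "\<And>k. 0 \<le> u k" "\<And>k. k \<notin> T \<Longrightarrow> u k = 0" "\<phi> = (\<Sum>k\<in>UNIV. u k *\<^sub>R a k)"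
    by (rule convex_cone_hull_finite_image) blast
  then show thesis
    by (intro that[of u]) (auto simp: T_def)
qed

subsection \<open>Block vectors\<close>

lemma sum_UNIV_Plus:
  "(\<Sum>k\<in>UNIV. h k) = (\<Sum>i\<in>UNIV. h (Inl i)) + (\<Sum>j\<in>UNIV. h (Inr j))"
  for h :: "'i::finite + 'j::finite \<Rightarrow> 'b::comm_monoid_add"
  unfolding UNIV_Plus_UNIV[symmetric] by (subst sum.Plus) auto

lemma vjoin_nth [simp]: "vjoin u v $ Inl i = u $ i" "vjoin u v $ Inr j = v $ j"
  by (simp_all add: vjoin_def)

lemma vjoin_surj: "\<exists>u v. z = vjoin u v"
proof (intro exI)
  show "z = vjoin (\<chi> i. z $ Inl i) (\<chi> j. z $ Inr j)"
    by (simp add: vec_eq_iff vjoin_def split: sum.split)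
qed

lemma all_vjoin: "(\<forall>z. P z) \<longleftrightarrow> (\<forall>u v. P (vjoin u v))"
  using vjoin_surj by metis

lemma ex_vjoin: "(\<exists>z. P z) \<longleftrightarrow> (\<exists>u v. P (vjoin u v))"
  using vjoin_surj by metis

text \<open>Bridges the scalar budget multiplier and the one-dimensional last block of the
  complementarity vector.\<close>

lemma ex_vec1: "(\<exists>z :: 'b ^ 1. P z) \<longleftrightarrow> (\<exists>r. P (vec r))"
proof -
  have "z = vec (z $ 1)" for z :: "'b ^ 1"
    by (simp add: vec_eq_iff)
  then show ?thesis by metis
qed

lemma vjoin_add: "vjoin u v + vjoin u' v' = vjoin (u + u') (v + v')"
  by (simp add: vec_eq_iff vjoin_def split: sum.split)

lemma vjoin_0: "vjoin 0 0 = 0"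
  by (simp add: vec_eq_iff vjoin_def split: sum.split)

lemma vjoin_sum: "(\<Sum>g\<in>S. vjoin (u g) (v g)) = vjoin (sum u S) (sum v S)"
  by (induction S rule: infinite_finite_induct) (simp_all add: vjoin_0 vjoin_add)

lemma vjoin_nonneg_iff [simp]: "0 \<le> vjoin u v \<longleftrightarrow> 0 \<le> u \<and> 0 \<le> v"
  by (auto simp: less_eq_vec_def vjoin_def split: sum.split)

lemma inner_vjoin [simp]: "vjoin u v \<bullet> vjoin u' v' = u \<bullet> u' + v \<bullet> v'"
  by (simp add: inner_vec_def sum_UNIV_Plus)

lemma block_mat_mult_vjoin:
  "block_mat P Q R S *v vjoin u v = vjoin (P *v u + Q *v v) (R *v u + S *v v)"
  by (simp add: vec_eq_iff block_mat_def matrix_vector_mul_component vjoin_def[of "_ + _"] split: sum.split)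

lemma stack_nth [simp]: "stack W $ (f, i) = W f $ i"
  by (simp add: stack_def)

lemma stack_nonneg_iff: "0 \<le> stack W \<longleftrightarrow> (\<forall>f. 0 \<le> W f)"
  by (auto simp: less_eq_vec_def)

lemma stack_add: "stack U + stack V = stack (\<lambda>f. U f + V f)"
  by (simp add: vec_eq_iff)

lemma inner_stack: "stack U \<bullet> stack V = (\<Sum>f\<in>UNIV. U f \<bullet> V f)"
  by (simp add: inner_vec_def UNIV_Times_UNIV[symmetric] sum.cartesian_product'
      del: UNIV_Times_UNIV)

lemma inner_vec_nonneg: "0 \<le> u \<Longrightarrow> 0 \<le> v \<Longrightarrow> 0 \<le> u \<bullet> v" for u v :: "real ^ 'i"
  by (auto simp: inner_vec_def less_eq_vec_def intro!: sum_nonneg)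

subsection \<open>Linear programs as complementarity problems\<close>

text \<open>The skew block structure separates primal feasibility from dual feasibility;
  complementary slackness remains as a single sum.\<close>

lemma lp_lcp_iff:
  "lcp_solution (vjoin \<phi> p) (block_mat 0 (- transpose A) A 0) (vjoin z \<mu>) \<longleftrightarrow>
    0 \<le> z \<and> 0 \<le> \<mu> \<and> 0 \<le> \<phi> - transpose A *v \<mu> \<and> 0 \<le> p + A *v z \<and>
    z \<bullet> (\<phi> - transpose A *v \<mu>) + \<mu> \<bullet> (p + A *v z) = 0"
proof -
  have "- transpose A *v \<mu> = - (transpose A *v \<mu>)"
    using matrix_vector_mult_diff_rdistrib[of 0 "transpose A" \<mu>] by simp
  then show ?thesis
    by (auto simp: lcp_solution_def block_mat_mult_vjoin vjoin_add)
qed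

text \<open>Only the row multipliers \<open>\<mu>\<close> are variables of the complementarity
  problem; those of the sign constraints reappear as the dual slack
  \<open>\<phi> - transpose A *v \<mu>\<close>.\<close>

lemma lp_optimal_iff_lcp:
  fixes A :: "real ^ 'n ^ 'm"
  shows "(0 \<le> z \<and> 0 \<le> p + A *v z \<and> (\<forall>z'. 0 \<le> z' \<and> 0 \<le> p + A *v z' \<longrightarrow> \<phi> \<bullet> z \<le> \<phi> \<bullet> z')) \<longleftrightarrow>
    (\<exists>\<mu>. lcp_solution (vjoin \<phi> p) (block_mat 0 (- transpose A) A 0) (vjoin z \<mu>))"
    (is "?opt \<longleftrightarrow> ?lcp")
proof
  assume opt: ?opt
  \<comment> \<open>Sign constraints (\<open>Inl\<close>) and rows (\<open>Inr\<close>) are merged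
    into one family \<open>\<beta> k \<le> a k \<bullet> z\<close>.\<close>
  define a :: "'n + 'm \<Rightarrow> real ^ 'n" where "a = case_sum (\<lambda>i. axis i 1) (\<lambda>j. A $ j)"
  define \<beta> :: "'n + 'm \<Rightarrow> real" where "\<beta> = case_sum (\<lambda>_. 0) (\<lambda>j. - p $ j)"
  have feas: "(\<forall>k. \<beta> k \<le> a k \<bullet> z') \<longleftrightarrow> 0 \<le> z' \<and> 0 \<le> p + A *v z'" for z'
  proof -
    have "- r \<le> r' \<longleftrightarrow> 0 \<le> r + r'" for r r' :: real by linarith
    then show ?thesis
      by (auto simp: a_def \<beta>_def less_eq_vec_def inner_axis' matrix_vector_mul_component
          split: sum.split)
  qed
  obtain u where u: "\<And>k. 0 \<le> u k" "\<And>k. u k * (a k \<bullet> z - \<beta> k) = 0"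
    "\<phi> = (\<Sum>k\<in>UNIV. u k *\<^sub>R a k)"
    by (rule lp_minimum_multipliers[of \<beta> a z \<phi>]) (use opt feas in blast)+
  define \<mu> where "\<mu> = (\<chi> j. u (Inr j))"
  have dual: "\<phi> - transpose A *v \<mu> = (\<chi> i. u (Inl i))"
    by (simp add: u(3) sum_UNIV_Plus vec_eq_iff a_def \<mu>_def matrix_vector_mult_def transpose_def
        axis_def mult.commute if_distrib[of "\<lambda>r. _ * r"] cong: if_cong)
  have "z \<bullet> (\<phi> - transpose A *v \<mu>) = 0"
    using u(2)[of "Inl _"] unfolding dual
    by (auto simp: inner_vec_def[of z] a_def \<beta>_def inner_axis' mult.commute intro!: sum.neutral)
  moreover have "\<mu> \<bullet> (p + A *v z) = 0"
    using u(2)[of "Inr _"] unfolding inner_vec_def[of \<mu>]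
    by (auto simp: \<mu>_def a_def \<beta>_def matrix_vector_mul_component add.commute
        intro!: sum.neutral)
  moreover have "0 \<le> \<mu>" "0 \<le> \<phi> - transpose A *v \<mu>"
    unfolding dual by (simp_all add: less_eq_vec_def \<mu>_def u(1))
  ultimately show ?lcp
    using opt unfolding lp_lcp_iff by auto
next
  assume ?lcp
  then obtain \<mu> where \<mu>: "0 \<le> z" "0 \<le> \<mu>" "0 \<le> \<phi> - transpose A *v \<mu>" "0 \<le> p + A *v z"
    "z \<bullet> (\<phi> - transpose A *v \<mu>) + \<mu> \<bullet> (p + A *v z) = 0"
    unfolding lp_lcp_iff by blast
  \<comment> \<open>Weak duality: up to the constant \<open>\<mu> \<bullet> p\<close>, the objective
    is a sum that is nonnegative at feasible points and zero at \<open>z\<close>.\<close>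
  have split: "\<phi> \<bullet> z' = z' \<bullet> (\<phi> - transpose A *v \<mu>) + \<mu> \<bullet> (p + A *v z') - \<mu> \<bullet> p" for z'
    using dot_lmul_matrix[of \<mu> A z']
    by (simp add: inner_diff_right inner_add_right inner_commute)
  have "\<phi> \<bullet> z \<le> \<phi> \<bullet> z'" if "0 \<le> z'" "0 \<le> p + A *v z'" for z'
    using inner_vec_nonneg[OF that(1) \<mu>(3)] inner_vec_nonneg[OF \<mu>(2) that(2)] \<mu>(5)
    unfolding split[of z] split[of z'] by linarith
  with \<mu>(1,4) show ?opt by simp
qed

subsection \<open>The interdiction game\<close>

text \<open>With all blocks nonnegative, the total scalar product vanishes only if each agent's
  summand does.\<close>

lemma lcp_stack_iff:
  "lcp_solution (stack q) M (stack W) \<longleftrightarrow> (\<forall>f. 0 \<le> W f \<and> 0 \<le> R f \<and> W f \<bullet> R f = 0)"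
  if "stack q + M *v stack W = stack R"
proof -
  have "(\<Sum>f\<in>UNIV. W f \<bullet> R f) = 0 \<longleftrightarrow> (\<forall>f. W f \<bullet> R f = 0)"
    if "\<forall>f. 0 \<le> W f" "\<forall>f. 0 \<le> R f"
    using that by (subst sum_nonneg_eq_0_iff) (auto intro: inner_vec_nonneg)
  then show ?thesis
    unfolding lcp_solution_def that stack_nonneg_iff inner_stack by blast
qed

lemma lcp_M_mult_stack:
  "lcp_M G c *v stack W =
    stack (\<lambda>f. M_diag G (c f) *v W f + (\<Sum>g\<in>UNIV - {f}. M_bar *v W g))"
proof -
  have "(lcp_M G c *v stack W) $ (f, i) =
      (M_diag G (c f) *v W f + (\<Sum>g\<in>UNIV - {f}. M_bar *v W g)) $ i" for f i
  proof -
    have "(lcp_M G c *v stack W) $ (f, i) =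
        (\<Sum>g\<in>UNIV. ((if f = g then M_diag G (c f) else M_bar) *v W g) $ i)"
      unfolding matrix_vector_mult_def
      by (simp add: lcp_M_def UNIV_Times_UNIV[symmetric] sum.cartesian_product'
          del: UNIV_Times_UNIV cong: if_cong)
    also have "\<dots> = (M_diag G (c f) *v W f) $ i + (\<Sum>g\<in>UNIV - {f}. (M_bar *v W g) $ i)"
      by (subst sum.remove[of _ f]) (auto intro!: sum.cong)
    finally show ?thesis by simp
  qed
  then show ?thesis
    by (simp add: vec_eq_iff)
qed

text \<open>The arc lengths agent \<open>f\<close> takes as given. Its own interdiction is left out
  because it is a decision variable, entering through the identity block of
  \<open>A_mat\<close>.\<close>

definition residual_lengths :: "real ^ 'a \<Rightarrow> ('f::finite \<Rightarrow> real ^ 'a) \<Rightarrow> 'f \<Rightarrow> real ^ 'a::finite" where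
  "residual_lengths d0 x f = d0 + (\<Sum>g\<in>UNIV - {f}. x g)"

lemma lcp_game_iff:
  fixes x lam :: "'f::finite \<Rightarrow> real ^ 'a::finite" and y :: "'f \<Rightarrow> real ^ 'v::finite"
  shows "lcp_solution (lcp_q s t d0 b) (lcp_M G c)
      (stack (\<lambda>f. vjoin (vjoin (x f) (y f)) (vjoin (lam f) (vec (bet f))))) \<longleftrightarrow>
    (\<forall>f. lcp_solution
      (vjoin (vjoin 0 (od_vec (s f) (t f))) (vjoin (residual_lengths d0 x f) (vec (b f))))
      (M_diag G (c f)) (vjoin (vjoin (x f) (y f)) (vjoin (lam f) (vec (bet f)))))"
    (is "lcp_solution _ _ (stack ?W) \<longleftrightarrow> (\<forall>f. lcp_solution (?q f) _ _)")
proof -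
  \<comment> \<open>\<open>M_bar\<close> moves \<open>x g\<close> into the arc-length block, so the
    other agents' contributions can be absorbed into the constant term, turning \<open>d0\<close>
    into \<open>residual_lengths\<close>.\<close>
  have "M_bar *v ?W g = vjoin 0 (vjoin (x g) 0)" for g
    by (simp add: M_bar_def block_mat_mult_vjoin vjoin_0)
  then have "(\<Sum>g\<in>UNIV - {f}. M_bar *v ?W g) = vjoin 0 (vjoin (\<Sum>g\<in>UNIV - {f}. x g) 0)" for f
    by (simp add: vjoin_sum)
  moreover have "?q f = vjoin (vjoin 0 (od_vec (s f) (t f))) (vjoin d0 (vec (b f))) +
      vjoin 0 (vjoin (\<Sum>g\<in>UNIV - {f}. x g) 0)" for f
    by (simp add: vjoin_add residual_lengths_def)
  ultimately have "lcp_q s t d0 b + lcp_M G c *v stack ?W =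
      stack (\<lambda>f. ?q f + M_diag G (c f) *v ?W f)"
    unfolding lcp_q_def lcp_M_mult_stack stack_add by (simp add: ac_simps)
  then show ?thesis
    unfolding lcp_q_def by (subst lcp_stack_iff) (auto simp: lcp_solution_def)
qed

lemma agent_feasible_iff:
  assumes "arcs G = UNIV"
  shows "agent_feasible G d0 b c f X (xf, yf) \<longleftrightarrow>
    0 \<le> vjoin xf yf \<and>
    0 \<le> vjoin (residual_lengths d0 X f) (vec (b f)) + A_mat G (c f) *v vjoin xf yf"
proof -
  \<comment> \<open>The total interdiction splits into the agent's own part, a column of
    \<open>A_mat\<close>, and the fixed part in \<open>residual_lengths\<close>.\<close>
  have total: "(\<Sum>g\<in>UNIV. (X(f := xf)) g $ a) = xf $ a + (\<Sum>g\<in>UNIV - {f}. X g $ a)" for a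
    by (subst sum.remove[of _ f]) (auto intro!: sum.cong)
  have inc: "(incidence G *v yf) $ a = yf $ tail G a - yf $ head G a" for a
    by (simp add: matrix_vector_mul_component incidence_def inner_diff_left inner_axis')
  have cost: "(- rowvector (c f) *v xf) $ i = - (\<Sum>a\<in>UNIV. c f $ a * xf $ a)" for i
    by (simp add: matrix_vector_mult_def rowvector_def sum_negf)
  have "0 \<le> vjoin (residual_lengths d0 X f) (vec (b f)) + A_mat G (c f) *v vjoin xf yf \<longleftrightarrow>
    (\<forall>a. yf $ head G a - yf $ tail G a \<le> d0 $ a + (xf $ a + (\<Sum>g\<in>UNIV - {f}. X g $ a))) \<and>
    (\<Sum>a\<in>UNIV. c f $ a * xf $ a) \<le> b f"
    unfolding A_mat_def block_mat_mult_vjoin vjoin_add vjoin_nonneg_iff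
    by (simp add: less_eq_vec_def inc cost residual_lengths_def algebra_simps)
  then show ?thesis
    unfolding agent_feasible_def case_prod_conv total assms vjoin_nonneg_iff[of xf yf]
    by (simp only: ball_UNIV conj_ac)
qed

lemma agent_optimal_iff_lcp:
  assumes "arcs G = UNIV"
  shows "agent_optimal G s t d0 b c f X (xf, yf) \<longleftrightarrow>
    (\<exists>lam bet. lcp_solution
      (vjoin (vjoin 0 (od_vec (s f) (t f))) (vjoin (residual_lengths d0 X f) (vec (b f))))
      (M_diag G (c f)) (vjoin (vjoin xf yf) (vjoin lam (vec bet))))"
proof -
  let ?\<phi> = "vjoin 0 (od_vec (s f) (t f))"
  let ?feas = "\<lambda>z. 0 \<le> z \<and>
    0 \<le> vjoin (residual_lengths d0 X f) (vec (b f)) + A_mat G (c f) *v z"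
  \<comment> \<open>This is the negative of the agent's payoff, so maximizing the payoff means
    minimizing \<open>?\<phi>\<close>.\<close>
  have obj: "?\<phi> \<bullet> vjoin x' y' = y' $ s f - y' $ t f" for x' y'
    by (simp add: od_vec_def inner_diff_left inner_axis')
  have "agent_optimal G s t d0 b c f X (xf, yf) \<longleftrightarrow>
      ?feas (vjoin xf yf) \<and>
      (\<forall>x' y'. ?feas (vjoin x' y') \<longrightarrow> ?\<phi> \<bullet> vjoin xf yf \<le> ?\<phi> \<bullet> vjoin x' y')"
    unfolding agent_optimal_def case_prod_conv agent_feasible_iff[OF assms] obj
    by (simp add: algebra_simps)
  also have "\<dots> \<longleftrightarrow> ?feas (vjoin xf yf) \<and> (\<forall>z'. ?feas z' \<longrightarrow> ?\<phi> \<bullet> vjoin xf yf \<le> ?\<phi> \<bullet> z')"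
    by (simp only: all_vjoin)
  also have "\<dots> \<longleftrightarrow> (\<exists>\<mu>. lcp_solution
      (vjoin ?\<phi> (vjoin (residual_lengths d0 X f) (vec (b f)))) (M_diag G (c f)) (vjoin (vjoin xf yf) \<mu>))"
    unfolding M_diag_def lp_optimal_iff_lcp[symmetric] by (simp only: conj_assoc conj_imp_eq_imp_imp)
  finally show ?thesis
    \<comment> \<open>The multiplier vector is split into its arc block \<open>lam\<close> and its
      budget entry \<open>bet\<close>.\<close>
    by (simp only: ex_vjoin ex_vec1)
qed

theorem mainTheorem4:
  fixes G :: "('v::finite, 'a::finite) pre_digraph"
    and s t :: "'f::finite \<Rightarrow> 'v"
    and d0 :: "real ^ 'a"
    and b :: "'f \<Rightarrow> real"
    and c :: "'f \<Rightarrow> real ^ 'a"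
    and x :: "'f \<Rightarrow> real ^ 'a"
    and y :: "'f \<Rightarrow> real ^ 'v"
  assumes "fin_digraph G" and "nomulti_digraph G"
    and "verts G = UNIV" and "arcs G = UNIV"
    and "\<And>f. s f \<rightarrow>\<^sup>*\<^bsub>G\<^esub> t f"
    and "\<And>f. b f > 0"
    and "\<And>f a. c f $ a > 0"
    and "\<And>a. d0 $ a > 0"
  shows "dspi_equilibrium G s t d0 b c (\<lambda>f. (x f, y f)) \<longleftrightarrow>
    (\<exists>(lam :: 'f \<Rightarrow> real ^ 'a) (bet :: 'f \<Rightarrow> real).
       lcp_solution (lcp_q s t d0 b) (lcp_M G c)
         (stack (\<lambda>f. vjoin (vjoin (x f) (y f)) (vjoin (lam f) (vec (bet f))))))"
  unfolding dspi_equilibrium_def agent_optimal_iff_lcp[OF \<open>arcs G = UNIV\<close>] lcp_game_iff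
  \<comment> \<open>Multipliers exist separately for each agent; choice collects them into the
    functions \<open>lam\<close> and \<open>bet\<close>.\<close>
  by (simp add: choice_iff)

end
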